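(* Let $r$ be an even integer and $s$ any integer. Then $$\sum_{n = 1}^\infty \frac{2^{2n}\, n\,F_{rn + s}}{(2n + 1)L_r^n C_n} = \left( F_{3r + s} + \frac{L_r}{2}F_{2r + s} \right)\frac{L_r}{2}+\left( L_r L_{2r + s} - 4L_{3r + s} \right)\frac{L_r^2}{4\sqrt 5}\arctan (\beta ^r ) + \left( 4L_{3r + s} - L_r L_{2r + s} + (4F_{3r + s} - L_r F_{2r + s} )\sqrt 5 \right)\frac{\pi L_r^2}{16\sqrt 5}$$ and $$\sum_{n = 1}^\infty \frac{2^{2n}\, n\,L_{rn + s}}{(2n + 1)L_r^n C_n} = \left( L_{3r + s} + \frac{L_r}{2}L_{2r + s} \right)\frac{L_r}{2} + \left( L_r F_{2r + s} - 4F_{3r + s} \right)\frac{L_r^2\sqrt 5}{4}\arctan (\beta ^r ) + \left( 4L_{3r + s} - L_r L_{2r + s} + (4F_{3r + s} - L_r F_{2r + s} )\sqrt 5 \right)\frac{\pi L_r^2}{16}.$$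
   Context: $C_n=\frac{1}{n+1}\binom{2n}{n}$ ($n\ge0$) is the $n$-th Catalan number and $\beta=\frac{1-\sqrt5}{2}$. $F_n$ and $L_n$ are the Fibonacci and Lucas numbers: $F_0=0$, $F_1=1$, $F_{n+2}=F_{n+1}+F_n$ and $L_0=2$, $L_1=1$, $L_{n+2}=L_{n+1}+L_n$, extended to negative indices by $F_{-n}=(-1)^{n+1}F_n$ and $L_{-n}=(-1)^nL_n$. $L_r^n$ means $(L_r)^n$. *)

theory Defs
  imports "HOL-Analysis.Analysis" "HOL-Number_Theory.Fib"
begin

definition catalan :: "nat \<Rightarrow> real" where
  "catalan n = 1 / real (n + 1) * real ((2 * n) choose n)"

fun lucas :: "nat \<Rightarrow> nat" where
  "lucas 0 = 2"
| "lucas (Suc 0) = 1"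
| "lucas (Suc (Suc n)) = lucas (Suc n) + lucas n"

definition fib_int :: "int \<Rightarrow> int" where
  "fib_int k = (if k \<ge> 0 then int (fib (nat k))
                else (- 1) ^ (nat (- k) + 1) * int (fib (nat (- k))))"

definition lucas_int :: "int \<Rightarrow> int" where
  "lucas_int k = (if k \<ge> 0 then int (lucas (nat k))
                  else (- 1) ^ nat (- k) * int (lucas (nat (- k))))"

definition beta :: real where
  "beta = (1 - sqrt 5) / 2"

end

theory Submission
  imports Defs
begin

text \<open>
  Write \<open>\<alpha>\<close>, \<open>\<beta>\<close> for the roots of \<open>x\<^sup>2 = x + 1\<close>. By Binet's formulas both series are linear
  combinations of the values of the single power series
  \<open>G(y) = \<Sum> n (n + 1) a\<^sub>n y\<^sup>n\<close>, where \<open>a\<^sub>n = 4\<^sup>n / ((2 n + 1) (2 n choose n))\<close>, at the two points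
  \<open>p = \<alpha>\<^sup>r / L\<^sub>r\<close> and \<open>q = \<beta>\<^sup>r / L\<^sub>r\<close>.

  The coefficients satisfy \<open>(2 n + 3) a\<^sub>n\<^sub>+\<^sub>1 = 2 (n + 1) a\<^sub>n\<close>. For \<open>H(y) = \<Sum> a\<^sub>n y\<^sup>n\<close> this says that
  \<open>(y H)' = (1 + H) / (2 (1 - y))\<close>. Read as a differential equation, it makes
  \<open>sin t cos t H(sin\<^sup>2 t)\<close> a function of \<open>t\<close> with derivative \<open>1\<close>, so that
  \<open>H(sin\<^sup>2 t) = t / (sin t cos t)\<close>; differentiated once more, it expresses \<open>G = y (y H)''\<close>
  rationally through \<open>H\<close>.

  For even \<open>r\<close> we have \<open>\<alpha>\<^sup>r \<beta>\<^sup>r = 1\<close> with both powers positive and adding up to \<open>L\<^sub>r\<close>. Hence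
  \<open>p + q = 1\<close>, \<open>p q = 1 / L\<^sub>r\<^sup>2\<close> and \<open>q / p = (\<beta>\<^sup>r)\<^sup>2\<close>: with \<open>t = arctan (\<beta>\<^sup>r)\<close> the two points
  are \<open>cos\<^sup>2 t\<close> and \<open>sin\<^sup>2 t\<close>. The angle belonging to \<open>p\<close> is therefore \<open>\<pi>/2 - t\<close>, which is
  where the terms with \<open>\<pi>\<close> come from.
\<close>

section \<open>A power series for \<open>t / (sin t cos t)\<close>\<close>

definition arcsin_coeff :: "nat \<Rightarrow> real" where
  "arcsin_coeff n = 4 ^ n / ((2 * real n + 1) * real ((2 * n) choose n))"

definition arcsin_series :: "real \<Rightarrow> real" where
  "arcsin_series y = (\<Sum>n. arcsin_coeff n * y ^ n)"

text \<open>
  The coefficients of \<open>y H(y)\<close>; the shift turns the weight \<open>n (n + 1)\<close> of the series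
  in question into two formal differentiations.
\<close>

definition shifted_coeff :: "nat \<Rightarrow> real" where
  "shifted_coeff n = (case n of 0 \<Rightarrow> 0 | Suc k \<Rightarrow> arcsin_coeff k)"

lemma DERIV_unique_locally_eq:
  fixes f g :: "real \<Rightarrow> real"
  assumes "(f has_field_derivative D) (at x)" "(g has_field_derivative E) (at x)"
    and "eventually (\<lambda>x. f x = g x) (nhds x)"
  shows "D = E"
  using assms(1,2) DERIV_cong_ev[OF refl assms(3) refl] DERIV_unique by metis

lemma central_binomial_Suc:
  "(real n + 1) * real ((2 * Suc n) choose Suc n) = 2 * (2 * real n + 1) * real ((2 * n) choose n)"
proof -
  have "Suc n * (Suc (Suc (2 * n)) choose Suc n) = Suc (Suc (2 * n)) * (Suc (2 * n) choose n)"
    by (rule Suc_times_binomial)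
  also have "\<dots> = Suc n * (2 * (Suc (2 * n) choose n))"
    by simp
  finally have "(Suc (Suc (2 * n)) choose Suc n) = 2 * (Suc (2 * n) choose n)"
    by (simp only: mult_cancel1) simp
  moreover have "Suc n * (Suc (2 * n) choose n) = Suc (2 * n) * ((2 * n) choose n)"
    using binomial_absorb_comp[of "Suc (2 * n)" n] by simp
  ultimately have "Suc n * ((2 * Suc n) choose Suc n) = 2 * (Suc (2 * n) * ((2 * n) choose n))"
    by (simp only: mult_Suc_right add_2_eq_Suc mult.left_commute)
  then have "real (Suc n * ((2 * Suc n) choose Suc n)) = real (2 * (Suc (2 * n) * ((2 * n) choose n)))"
    by (simp only:)
  then show ?thesis
    by (simp add: algebra_simps)
qed

lemma arcsin_coeff_0 [simp]: "arcsin_coeff 0 = 1"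
  by (simp add: arcsin_coeff_def)

lemma arcsin_coeff_pos: "0 < arcsin_coeff n"
  by (auto simp: arcsin_coeff_def intro!: divide_pos_pos mult_pos_pos)

lemma arcsin_coeff_Suc:
  "(2 * real n + 3) * arcsin_coeff (Suc n) = 2 * (real n + 1) * arcsin_coeff n"
proof -
  define b c where "b = real ((2 * n) choose n)" and "c = real ((2 * Suc n) choose Suc n)"
  have pos: "b > 0" "c > 0"
    by (auto simp: b_def c_def simp del: mult_Suc_right)
  have bc: "(real n + 1) * c = 2 * (2 * real n + 1) * b"
    using central_binomial_Suc[of n] by (simp add: b_def c_def)
  have nz: "3 + 2 * real n \<noteq> 0"
    using of_nat_0_le_iff[of n, where 'a = real] by linarith
  have "(2 * real n + 3) * arcsin_coeff (Suc n) = 4 * 4 ^ n / c"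
    using nz by (simp add: arcsin_coeff_def c_def[symmetric] add_ac del: mult_Suc_right)
  also have "\<dots> = (4 * 4 ^ n * (real n + 1)) / ((real n + 1) * c)"
    using pos by simp
  also have "\<dots> = 2 * (real n + 1) * (4 ^ n / ((2 * real n + 1) * b))"
  proof -
    have "(4 * x * i) / (2 * j * b) = 2 * i * (x / (j * b))" for x i j :: real
      by (simp add: mult.assoc)
    then show ?thesis
      unfolding bc .
  qed
  finally show ?thesis
    by (simp add: arcsin_coeff_def b_def)
qed

lemma arcsin_coeff_le_1: "arcsin_coeff n \<le> 1"
proof (induction n)
  case (Suc n)
  have "(2 * real n + 3) * arcsin_coeff (Suc n) \<le> (2 * real n + 3) * 1"
    unfolding arcsin_coeff_Suc using Suc arcsin_coeff_pos[of n]
    by (intro mult_mono) auto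
  then show ?case
    by (simp add: mult_le_cancel_left_pos)
qed simp

lemma summable_arcsin_coeff:
  assumes "norm (y :: real) < 1"
  shows "summable (\<lambda>n. arcsin_coeff n * y ^ n)"
proof (rule summable_comparison_test')
  show "summable (\<lambda>n. norm y ^ n)"
    using assms by (simp add: summable_geometric)
  show "norm (arcsin_coeff n * y ^ n) \<le> norm y ^ n" for n
    using arcsin_coeff_pos[of n] arcsin_coeff_le_1[of n]
    by (simp add: norm_mult norm_power abs_mult power_abs mult_left_le_one_le)
qed

lemma summable_shifted_coeff:
  assumes "norm (y :: real) < 1"
  shows "summable (\<lambda>n. shifted_coeff n * y ^ n)"
proof -
  have "summable (\<lambda>n. (arcsin_coeff n * y ^ n) * y)"
    by (intro summable_mult2 summable_arcsin_coeff assms)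
  then have "summable (\<lambda>n. shifted_coeff (Suc n) * y ^ Suc n)"
    by (simp add: shifted_coeff_def mult_ac)
  then show ?thesis
    by (subst (asm) summable_Suc_iff)
qed

lemma diffs_shifted_coeff: "diffs shifted_coeff n = (real n + 1) * arcsin_coeff n"
  by (simp add: diffs_def shifted_coeff_def algebra_simps)

lemma diffs2_shifted_coeff:
  "diffs (diffs shifted_coeff) n = (real n + 1) * (real n + 2) * arcsin_coeff (Suc n)"
  by (subst diffs_def) (simp add: diffs_shifted_coeff algebra_simps)

lemma summable_diffs_shifted_coeff:
  assumes "norm (y :: real) < 1"
  shows "summable (\<lambda>n. diffs shifted_coeff n * y ^ n)"
  using termdiff_converges[OF assms summable_shifted_coeff] .

lemma summable_diffs2_shifted_coeff:
  assumes "norm (y :: real) < 1"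
  shows "summable (\<lambda>n. diffs (diffs shifted_coeff) n * y ^ n)"
  using termdiff_converges[OF assms summable_diffs_shifted_coeff] .

text \<open>
  This is the recurrence of the coefficients: in \<open>(1 - y) \<Sum> 2 (n + 1) a\<^sub>n y\<^sup>n\<close> the coefficient of
  \<open>y\<^sup>n\<^sup>+\<^sup>1\<close> is \<open>2 (n + 2) a\<^sub>n\<^sub>+\<^sub>1 - (2 n + 3) a\<^sub>n\<^sub>+\<^sub>1 = a\<^sub>n\<^sub>+\<^sub>1\<close>, while the constant term
  is \<open>2 = 1 + a\<^sub>0\<close>.
\<close>

lemma suminf_diffs_shifted_coeff:
  assumes y: "norm (y :: real) < 1"
  shows "(\<Sum>n. diffs shifted_coeff n * y ^ n) = (1 + arcsin_series y) / (2 * (1 - y))"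
proof -
  define D where "D = (\<Sum>n. diffs shifted_coeff n * y ^ n)"
  have D: "(\<lambda>n. diffs shifted_coeff n * y ^ n) sums D"
    unfolding D_def using summable_diffs_shifted_coeff[OF y] by (rule summable_sums)
  have H: "(\<lambda>n. arcsin_coeff n * y ^ n) sums arcsin_series y"
    unfolding arcsin_series_def using summable_arcsin_coeff[OF y] by (rule summable_sums)
  have D': "(\<lambda>n. diffs shifted_coeff (Suc n) * y ^ Suc n) sums (D - 1)"
    using D by (subst sums_Suc_iff) (simp add: diffs_shifted_coeff)
  have H': "(\<lambda>n. arcsin_coeff (Suc n) * y ^ Suc n) sums (arcsin_series y - 1)"
    using H by (subst sums_Suc_iff) simp
  have "(\<lambda>n. 2 * (diffs shifted_coeff (Suc n) * y ^ Suc n)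
              - 2 * y * (diffs shifted_coeff n * y ^ n)) sums (2 * (D - 1) - 2 * y * D)"
    by (intro sums_diff sums_mult D D')
  also have "(\<lambda>n. 2 * (diffs shifted_coeff (Suc n) * y ^ Suc n)
              - 2 * y * (diffs shifted_coeff n * y ^ n)) = (\<lambda>n. arcsin_coeff (Suc n) * y ^ Suc n)"
  proof
    fix n
    have "2 * (diffs shifted_coeff (Suc n) * y ^ Suc n) - 2 * y * (diffs shifted_coeff n * y ^ n)
        = y ^ Suc n * (2 * (real n + 2) * arcsin_coeff (Suc n) - 2 * (real n + 1) * arcsin_coeff n)"
      by (simp add: diffs_shifted_coeff algebra_simps)
    also have "\<dots> = arcsin_coeff (Suc n) * y ^ Suc n"
      unfolding arcsin_coeff_Suc[symmetric] by (simp add: algebra_simps)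
    finally show "2 * (diffs shifted_coeff (Suc n) * y ^ Suc n)
        - 2 * y * (diffs shifted_coeff n * y ^ n) = arcsin_coeff (Suc n) * y ^ Suc n" .
  qed
  finally have "2 * (D - 1) - 2 * y * D = arcsin_series y - 1"
    using H' by (rule sums_unique2)
  then have "D = (1 + arcsin_series y) / (2 * (1 - y))"
    using y by (simp add: field_simps)
  then show ?thesis
    by (simp only: D_def)
qed

text \<open>
  The differential equation of \<open>H\<close>: the series summed just above is the termwise derivative of
  \<open>y H(y)\<close>, so it equals \<open>H + y H'\<close>.
\<close>

lemma DERIV_arcsin_series:
  assumes y: "norm (y :: real) < 1"
  obtains H' where "(arcsin_series has_field_derivative H') (at y)"
    and "2 * y * (1 - y) * H' = 1 - (1 - 2 * y) * arcsin_series y"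
proof
  define H' where "H' = (\<Sum>n. diffs arcsin_coeff n * y ^ n)"
  show H': "(arcsin_series has_field_derivative H') (at y)"
    unfolding arcsin_series_def H'_def
    by (rule termdiffs_strong'[OF summable_arcsin_coeff y])
  have "((\<lambda>y. \<Sum>n. shifted_coeff n * y ^ n) has_field_derivative
      (\<Sum>n. diffs shifted_coeff n * y ^ n)) (at y)"
    by (rule termdiffs_strong'[OF summable_shifted_coeff y])
  moreover have "((\<lambda>y. y * arcsin_series y) has_field_derivative
      (arcsin_series y + y * H')) (at y)"
    by (auto intro!: derivative_eq_intros H')
  moreover have "eventually (\<lambda>x. (\<Sum>n. shifted_coeff n * x ^ n) = x * arcsin_series x) (nhds y)"
  proof -
    have "eventually (\<lambda>x. x \<in> ball 0 1) (nhds y)"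
      using y by (intro eventually_nhds_in_open) auto
    then show ?thesis
    proof eventually_elim
      case (elim x)
      then have x: "norm x < 1" by simp
      have "(\<lambda>n. x * (arcsin_coeff n * x ^ n)) sums (x * arcsin_series x)"
        unfolding arcsin_series_def by (intro sums_mult summable_sums summable_arcsin_coeff x)
      then have "(\<lambda>n. shifted_coeff (Suc n) * x ^ Suc n) sums (x * arcsin_series x)"
        by (simp add: shifted_coeff_def mult_ac)
      then have "(\<lambda>n. shifted_coeff n * x ^ n) sums (x * arcsin_series x)"
        by (subst (asm) sums_Suc_iff) (simp add: shifted_coeff_def)
      then show ?case
        by (rule sums_unique[symmetric])
    qed
  qed
  ultimately have "(\<Sum>n. diffs shifted_coeff n * y ^ n) = arcsin_series y + y * H'"
    by (rule DERIV_unique_locally_eq)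
  moreover have "(\<Sum>n. diffs shifted_coeff n * y ^ n) = (1 + arcsin_series y) / (2 * (1 - y))"
    by (rule suminf_diffs_shifted_coeff[OF y])
  ultimately have "(arcsin_series y + y * H') * (2 * (1 - y)) = 1 + arcsin_series y"
    using y by (simp add: field_simps)
  then show "2 * y * (1 - y) * H' = 1 - (1 - 2 * y) * arcsin_series y"
    by (simp add: algebra_simps)
qed

text \<open>
  With \<open>y = sin\<^sup>2 t\<close> the derivative of \<open>sin t cos t H(sin\<^sup>2 t)\<close> is
  \<open>(1 - 2 y) H + 2 y (1 - y) H'\<close>, which is \<open>1\<close> by the differential equation.
\<close>

lemma arcsin_series_sin_squared:
  assumes t: "0 \<le> t" "t < pi / 2"
  shows "sin t * cos t * arcsin_series ((sin t)\<^sup>2) = t"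
proof -
  define f where "f = (\<lambda>t. sin t * cos t * arcsin_series ((sin t)\<^sup>2) - t)"
  have "(f has_field_derivative 0) (at x within {-pi/2<..<pi/2})" if x: "x \<in> {-pi/2<..<pi/2}" for x
  proof -
    have "0 < cos x"
      using x by (intro cos_gt_zero_pi) auto
    then have cs: "(cos x)\<^sup>2 > 0" by simp
    have c2: "(cos x)\<^sup>2 = 1 - (sin x)\<^sup>2"
      by (simp add: cos_squared_eq)
    have "norm ((sin x)\<^sup>2) < 1"
      using cs c2 by simp
    then obtain H' where H': "(arcsin_series has_field_derivative H') (at ((sin x)\<^sup>2))"
      and ode: "2 * (sin x)\<^sup>2 * (1 - (sin x)\<^sup>2) * H' = 1 - (1 - 2 * (sin x)\<^sup>2) * arcsin_series ((sin x)\<^sup>2)"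
      by (rule DERIV_arcsin_series)
    have "((\<lambda>t. (sin t)\<^sup>2) has_field_derivative (2 * sin x * cos x)) (at x)"
      by (auto intro!: derivative_eq_intros)
    from DERIV_chain2[OF H' this]
    have d: "((\<lambda>t. arcsin_series ((sin t)\<^sup>2)) has_field_derivative (H' * (2 * sin x * cos x))) (at x)" .
    have "(f has_field_derivative
        ((cos x)\<^sup>2 - (sin x)\<^sup>2) * arcsin_series ((sin x)\<^sup>2)
          + 2 * (sin x)\<^sup>2 * (cos x)\<^sup>2 * H' - 1) (at x)"
      unfolding f_def by (rule derivative_eq_intros d refl)+ (simp add: algebra_simps power2_eq_square)
    also have "((cos x)\<^sup>2 - (sin x)\<^sup>2) * arcsin_series ((sin x)\<^sup>2)
          + 2 * (sin x)\<^sup>2 * (cos x)\<^sup>2 * H' - 1 = 0"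
      unfolding c2 using ode by (simp add: algebra_simps)
    finally show ?thesis
      by (rule has_field_derivative_at_within)
  qed
  then have "\<exists>c. \<forall>x\<in>{-pi/2<..<pi/2}. f x = c"
    by (intro has_field_derivative_zero_constant) auto
  then obtain c where c: "\<And>x. x \<in> {-pi/2<..<pi/2} \<Longrightarrow> f x = c"
    by blast
  have "f t = f 0"
    using c[of t] c[of 0] t pi_gt_zero by simp
  then show ?thesis
    by (simp add: f_def)
qed

text \<open>
  The series represents \<open>y (y H)''\<close>; its value is found by differentiating
  \<open>(y H)' = (1 + H) / (2 (1 - y))\<close> and eliminating \<open>H'\<close> with the differential equation.
\<close>

lemma weighted_arcsin_series_sums:
  assumes y: "norm (y :: real) < 1"
  shows "(\<lambda>n. (real n + 1) * (real n + 2) * arcsin_coeff (Suc n) * y ^ Suc n)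
    sums ((1 + 2 * y + (4 * y - 1) * arcsin_series y) / (4 * (1 - y)\<^sup>2))"
proof -
  obtain H' where H': "(arcsin_series has_field_derivative H') (at y)"
    and ode: "2 * y * (1 - y) * H' = 1 - (1 - 2 * y) * arcsin_series y"
    using DERIV_arcsin_series[OF y] .
  have y1: "1 - y \<noteq> 0" using y by auto
  define E where "E = (\<Sum>n. diffs (diffs shifted_coeff) n * y ^ n)"
  have "((\<lambda>y. \<Sum>n. diffs shifted_coeff n * y ^ n) has_field_derivative E) (at y)"
    unfolding E_def by (rule termdiffs_strong'[OF summable_diffs_shifted_coeff y])
  moreover have "((\<lambda>y. (1 + arcsin_series y) / (2 * (1 - y))) has_field_derivative
      (H' * (1 - y) + (1 + arcsin_series y)) / (2 * (1 - y)\<^sup>2)) (at y)"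
    using y1
    by (auto intro!: derivative_eq_intros H' simp: divide_simps power2_eq_square)
      (simp add: algebra_simps)
  moreover have "eventually (\<lambda>x. (\<Sum>n. diffs shifted_coeff n * x ^ n)
      = (1 + arcsin_series x) / (2 * (1 - x))) (nhds y)"
  proof -
    have "eventually (\<lambda>x. x \<in> ball 0 1) (nhds y)"
      using y by (intro eventually_nhds_in_open) auto
    then show ?thesis
      by eventually_elim (simp add: suminf_diffs_shifted_coeff)
  qed
  ultimately have E: "E = (H' * (1 - y) + (1 + arcsin_series y)) / (2 * (1 - y)\<^sup>2)"
    by (rule DERIV_unique_locally_eq)
  have "y * E = (2 * y * (1 - y) * H' + 2 * y * (1 + arcsin_series y)) / (4 * (1 - y)\<^sup>2)"
    unfolding E using y1 by (simp add: field_simps)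
  also have "\<dots> = (1 + 2 * y + (4 * y - 1) * arcsin_series y) / (4 * (1 - y)\<^sup>2)"
    unfolding ode by (simp add: algebra_simps)
  finally have yE: "y * E = (1 + 2 * y + (4 * y - 1) * arcsin_series y) / (4 * (1 - y)\<^sup>2)" .
  have "(\<lambda>n. y * (diffs (diffs shifted_coeff) n * y ^ n)) sums (y * E)"
    unfolding E_def by (intro sums_mult summable_sums summable_diffs2_shifted_coeff y)
  then show ?thesis
    unfolding yE by (simp add: diffs2_shifted_coeff mult_ac)
qed

lemma catalan_term_eq:
  "2 ^ (2 * Suc m) * real (Suc m) / ((2 * real (Suc m) + 1) * catalan (Suc m))
    = (real m + 1) * (real m + 2) * arcsin_coeff (Suc m)"
proof -
  define c where "c = real ((2 * Suc m) choose Suc m)"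
  have "c > 0"
    by (auto simp: c_def simp del: mult_Suc_right)
  moreover have "(2 :: real) ^ (2 * Suc m) = 4 ^ Suc m"
    by (simp only: power_mult) simp
  ultimately show ?thesis
    unfolding catalan_def arcsin_coeff_def c_def[symmetric]
    by (simp add: field_simps del: power_Suc mult_Suc_right)
qed

section \<open>Binet's formulas for integer indices\<close>

definition alpha :: real where
  "alpha = (1 + sqrt 5) / 2"

lemma alpha_times_beta: "alpha * beta = -1"
  by (simp add: alpha_def beta_def field_simps)

lemma alpha_squared: "alpha * alpha = alpha + 1"
  by (simp add: alpha_def field_simps)

lemma beta_squared: "beta * beta = beta + 1"
  by (simp add: beta_def field_simps)

lemma alpha_nonzero: "alpha \<noteq> 0" and beta_nonzero: "beta \<noteq> 0"
  using alpha_times_beta by auto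

lemma alpha_minus_beta: "alpha - beta = sqrt 5"
  by (simp add: alpha_def beta_def field_simps)

lemma fib_binet: "real (fib n) * sqrt 5 = alpha ^ n - beta ^ n"
proof (induction n rule: fib.induct)
  case (3 n)
  have "real (fib (Suc (Suc n))) * sqrt 5 = (alpha ^ Suc n - beta ^ Suc n) + (alpha ^ n - beta ^ n)"
    using 3 by (simp add: algebra_simps)
  also have "\<dots> = alpha ^ n * (alpha + 1) - beta ^ n * (beta + 1)"
    by (simp add: algebra_simps)
  also have "\<dots> = alpha ^ Suc (Suc n) - beta ^ Suc (Suc n)"
    unfolding alpha_squared[symmetric] beta_squared[symmetric] by (simp add: mult_ac)
  finally show ?case .
qed (auto simp: alpha_minus_beta)

lemma lucas_binet: "real (lucas n) = alpha ^ n + beta ^ n"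
proof (induction n rule: lucas.induct)
  case 2
  show ?case by (simp add: alpha_def beta_def field_simps)
next
  case (3 n)
  have "real (lucas (Suc (Suc n))) = (alpha ^ Suc n + beta ^ Suc n) + (alpha ^ n + beta ^ n)"
    using 3 by (simp add: algebra_simps)
  also have "\<dots> = alpha ^ n * (alpha + 1) + beta ^ n * (beta + 1)"
    by (simp add: algebra_simps)
  also have "\<dots> = alpha ^ Suc (Suc n) + beta ^ Suc (Suc n)"
    unfolding alpha_squared[symmetric] beta_squared[symmetric] by (simp add: mult_ac)
  finally show ?case .
qed auto

lemma inverse_alpha_beta: "inverse alpha = - beta" "inverse beta = - alpha"
  using alpha_times_beta alpha_nonzero beta_nonzero
  by (simp_all add: field_simps)

text \<open>
  At negative indices the sign conventions match because
  \<open>\<alpha>\<^sup>-\<^sup>1 = - \<beta>\<close> and \<open>\<beta>\<^sup>-\<^sup>1 = - \<alpha>\<close>.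
\<close>

lemma fib_int_binet: "real_of_int (fib_int k) = (alpha powi k - beta powi k) / sqrt 5"
proof (cases "k \<ge> 0")
  case True
  then show ?thesis
    using fib_binet[of "nat k"] by (simp add: fib_int_def power_int_def field_simps)
next
  case False
  have fib: "real (fib (nat (- k))) = (alpha ^ nat (- k) - beta ^ nat (- k)) / sqrt 5"
    using fib_binet[of "nat (- k)"] by (simp add: field_simps)
  show ?thesis
    using False
    by (simp add: fib fib_int_def power_int_def inverse_alpha_beta power_minus[of alpha]
        power_minus[of beta] diff_divide_distrib algebra_simps)
qed

lemma lucas_int_binet: "real_of_int (lucas_int k) = alpha powi k + beta powi k"
proof (cases "k \<ge> 0")
  case True
  then show ?thesis
    using lucas_binet[of "nat k"] by (simp add: lucas_int_def power_int_def)
next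
  case False
  then show ?thesis
    using lucas_binet[of "nat (- k)"]
    by (simp add: lucas_int_def power_int_def inverse_alpha_beta power_minus[of alpha]
        power_minus[of beta] algebra_simps)
qed

section \<open>Evaluation at the two points\<close>

text \<open>
  Here \<open>u\<close> and \<open>v\<close> stand for \<open>\<alpha>\<^sup>r\<close> and \<open>\<beta>\<^sup>r\<close>, in either order. Since
  \<open>u\<^sup>2 = u / v\<close>, the angle \<open>t = arctan u\<close> has \<open>sin\<^sup>2 t = u / (u + v)\<close>,
  \<open>cos\<^sup>2 t = v / (u + v)\<close> and \<open>sin t cos t = 1 / (u + v)\<close>.
\<close>

lemma weighted_arcsin_series_at:
  assumes uv: "u * v = 1" and u: "(u :: real) > 0" and L: "L = u + v"
  shows "(\<lambda>n. (real n + 1) * (real n + 2) * arcsin_coeff (Suc n) * (u / L) ^ Suc n)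
    sums (L\<^sup>2 * u\<^sup>2 / 4 * (1 + 2 * u / L + (4 * u / L - 1) * (L * arctan u)))"
proof -
  have v: "v = 1 / u"
    using uv u by (simp add: field_simps)
  then have vpos: "v > 0"
    using u by simp
  have Lpos: "L > 0"
    using u vpos L by simp
  define t where "t = arctan u"
  have t: "0 \<le> t" "t < pi / 2"
    using u arctan_ubound by (auto simp: t_def)
  have Lu: "L = (1 + u\<^sup>2) / u"
    using u by (simp add: L v field_simps power2_eq_square)
  have pos: "1 + u\<^sup>2 > 0"
    by (simp add: add_pos_nonneg)
  have sc: "sin t * cos t = 1 / L"
    using pos by (simp add: t_def sin_arctan cos_arctan Lu)
  have s2: "(sin t)\<^sup>2 = u / L"
    using pos u by (simp add: t_def sin_arctan Lu power_divide power2_eq_square[of u])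
  have H: "arcsin_series (u / L) = L * arctan u"
    using arcsin_series_sin_squared[OF t] Lpos unfolding sc s2
    by (simp add: t_def[symmetric] field_simps)
  have "norm (u / L) < 1"
    using u vpos by (simp add: L)
  from weighted_arcsin_series_sums[OF this]
  have "(\<lambda>n. (real n + 1) * (real n + 2) * arcsin_coeff (Suc n) * (u / L) ^ Suc n)
    sums ((1 + 2 * (u / L) + (4 * (u / L) - 1) * (L * arctan u)) / (4 * (1 - u / L)\<^sup>2))"
    unfolding H .
  moreover have "1 - u / L = 1 / (u * L)"
  proof -
    have "1 - u / L = v / L"
      using Lpos by (simp add: L field_simps)
    then show ?thesis
      by (simp add: v)
  qed
  ultimately show ?thesis
    using u Lpos by (simp add: power_divide power_mult_distrib mult_ac)
qed

theorem theorem3: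
  fixes r s :: int
  assumes "even r"
  shows
    "(\<lambda>m. let n = Suc m in
        2 ^ (2 * n) * real n * real_of_int (fib_int (r * int n + s))
          / ((2 * real n + 1) * real_of_int (lucas_int r) ^ n * catalan n))
      sums
      ((fib_int (3 * r + s) + lucas_int r / 2 * fib_int (2 * r + s)) * (lucas_int r / 2)
        + (lucas_int r * lucas_int (2 * r + s) - 4 * lucas_int (3 * r + s))
            * ((lucas_int r)\<^sup>2 / (4 * sqrt 5)) * arctan (beta powi r)
        + (4 * lucas_int (3 * r + s) - lucas_int r * lucas_int (2 * r + s)
             + (4 * fib_int (3 * r + s) - lucas_int r * fib_int (2 * r + s)) * sqrt 5)
            * (pi * (lucas_int r)\<^sup>2 / (16 * sqrt 5)))
     \<and>
     (\<lambda>m. let n = Suc m in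
        2 ^ (2 * n) * real n * real_of_int (lucas_int (r * int n + s))
          / ((2 * real n + 1) * real_of_int (lucas_int r) ^ n * catalan n))
      sums
      ((lucas_int (3 * r + s) + lucas_int r / 2 * lucas_int (2 * r + s)) * (lucas_int r / 2)
        + (lucas_int r * fib_int (2 * r + s) - 4 * fib_int (3 * r + s))
            * ((lucas_int r)\<^sup>2 * sqrt 5 / 4) * arctan (beta powi r)
        + (4 * lucas_int (3 * r + s) - lucas_int r * lucas_int (2 * r + s)
             + (4 * fib_int (3 * r + s) - lucas_int r * fib_int (2 * r + s)) * sqrt 5)
            * (pi * (lucas_int r)\<^sup>2 / 16))"
proof -
  define u v L t where "u = alpha powi r" and "v = beta powi r"
    and "L = real_of_int (lucas_int r)" and "t = arctan v"
  define a b where "a = alpha powi s" and "b = beta powi s"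
  define g where "g = (\<lambda>m. (real m + 1) * (real m + 2) * arcsin_coeff (Suc m))"
  define A where "A = L\<^sup>2 * u\<^sup>2 / 4 * (1 + 2 * u / L + (4 * u / L - 1) * (L * (pi / 2 - t)))"
  define B where "B = L\<^sup>2 * v\<^sup>2 / 4 * (1 + 2 * v / L + (4 * v / L - 1) * (L * t))"
  have uv: "u * v = 1"
    using assms alpha_times_beta
    by (simp add: u_def v_def power_int_mult_distrib[symmetric])
  obtain k where "r = k * 2"
    using assms by (auto elim!: evenE)
  then have "u = (alpha powi k)\<^sup>2" "v = (beta powi k)\<^sup>2"
    by (simp_all add: u_def v_def power_int_mult)
  then have "u > 0" "v > 0"
    using alpha_nonzero beta_nonzero by simp_all
  have L: "L = u + v"
    by (simp add: L_def u_def v_def lucas_int_binet)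
  have Lpos: "L > 0"
    using \<open>u > 0\<close> \<open>v > 0\<close> by (simp add: L)
  have u_eq: "u = inverse v"
    using uv \<open>v > 0\<close> by (simp add: field_simps)
  have "arctan u = pi / 2 - t"
    using arctan_inverse[of v] \<open>v > 0\<close> by (simp add: u_eq t_def)
  then have SA: "(\<lambda>m. g m * (u / L) ^ Suc m) sums A"
    using weighted_arcsin_series_at[OF uv \<open>u > 0\<close> L] by (simp only: g_def A_def)
  have SB: "(\<lambda>m. g m * (v / L) ^ Suc m) sums B"
    using weighted_arcsin_series_at[of v u L] uv \<open>v > 0\<close> L
    by (simp only: g_def B_def t_def mult.commute add.commute)

  have pw: "alpha powi (r * int n + s) = u ^ n * a" "beta powi (r * int n + s) = v ^ n * b" for n
    using alpha_nonzero beta_nonzero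
    by (simp_all add: u_def v_def a_def b_def power_int_add power_int_mult)
  have F: "real_of_int (fib_int (r * int n + s)) = (u ^ n * a - v ^ n * b) / sqrt 5"
    and Lu: "real_of_int (lucas_int (r * int n + s)) = u ^ n * a + v ^ n * b" for n
    by (simp_all add: fib_int_binet lucas_int_binet pw)
  have F2: "real_of_int (fib_int (2 * r + s)) = (u ^ 2 * a - v ^ 2 * b) / sqrt 5"
    and F3: "real_of_int (fib_int (3 * r + s)) = (u ^ 3 * a - v ^ 3 * b) / sqrt 5"
    and L2: "real_of_int (lucas_int (2 * r + s)) = u ^ 2 * a + v ^ 2 * b"
    and L3: "real_of_int (lucas_int (3 * r + s)) = u ^ 3 * a + v ^ 3 * b"
    using F[of 2] F[of 3] Lu[of 2] Lu[of 3] by (simp_all add: mult.commute)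

  \<comment> \<open>Stated for any numerator \<open>z\<close>, so that it covers the Fibonacci and the Lucas series alike.\<close>
  have summand: "2 ^ (2 * Suc m) * real (Suc m) * z
      / ((2 * real (Suc m) + 1) * L ^ Suc m * catalan (Suc m)) = g m * (z / L ^ Suc m)" for m z
    unfolding g_def catalan_term_eq[symmetric] by (simp add: field_simps)

  have A': "A = L\<^sup>2 * u\<^sup>2 / 4 + L * u ^ 3 / 2 + (4 * u ^ 3 - L * u\<^sup>2) * L\<^sup>2 / 4 * (pi / 2 - t)"
    using Lpos unfolding A_def by (simp add: field_simps power2_eq_square power3_eq_cube)
  have B': "B = L\<^sup>2 * v\<^sup>2 / 4 + L * v ^ 3 / 2 + (4 * v ^ 3 - L * v\<^sup>2) * L\<^sup>2 / 4 * t"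
    using Lpos unfolding B_def by (simp add: field_simps power2_eq_square power3_eq_cube)

  have "(\<lambda>m. (a * (g m * (u / L) ^ Suc m) - b * (g m * (v / L) ^ Suc m)) / sqrt 5)
      sums ((a * A - b * B) / sqrt 5)"
    by (intro sums_divide sums_diff sums_mult SA SB)
  moreover have "(a * (g m * (u / L) ^ Suc m) - b * (g m * (v / L) ^ Suc m)) / sqrt 5
      = g m * ((u ^ Suc m * a - v ^ Suc m * b) / sqrt 5 / L ^ Suc m)" for m
    using Lpos by (simp add: power_divide field_simps)
  ultimately have 1: "(\<lambda>m. g m * ((u ^ Suc m * a - v ^ Suc m * b) / sqrt 5 / L ^ Suc m))
      sums ((a * A - b * B) / sqrt 5)"
    by simp
  have "(\<lambda>m. a * (g m * (u / L) ^ Suc m) + b * (g m * (v / L) ^ Suc m)) sums (a * A + b * B)"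
    by (intro sums_add sums_mult SA SB)
  moreover have "a * (g m * (u / L) ^ Suc m) + b * (g m * (v / L) ^ Suc m)
      = g m * ((u ^ Suc m * a + v ^ Suc m * b) / L ^ Suc m)" for m
    using Lpos by (simp add: power_divide field_simps)
  ultimately have 2: "(\<lambda>m. g m * ((u ^ Suc m * a + v ^ Suc m * b) / L ^ Suc m))
      sums (a * A + b * B)"
    by simp

  \<comment> \<open>Both closed forms are identities of rational functions in which \<open>sqrt 5\<close> may be any nonzero
    number \<open>w\<close>; abstracting it keeps the simplifier from reasoning about roots.\<close>
  define w where "w = sqrt 5"
  have w: "w \<noteq> 0" by (simp add: w_def)
  show ?thesis
    unfolding Let_def of_int_mult of_int_diff of_int_power of_int_numeral
      F Lu F2 F3 L2 L3 L_def[symmetric] v_def[symmetric] t_def[symmetric] summand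
  proof
    have "(a * A - b * B) / w =
       ((u ^ 3 * a - v ^ 3 * b) / w + L / 2 * ((u ^ 2 * a - v ^ 2 * b) / w)) * (L / 2)
        + (L * (u ^ 2 * a + v ^ 2 * b) - 4 * (u ^ 3 * a + v ^ 3 * b)) * (L\<^sup>2 / (4 * w)) * t
        + (4 * (u ^ 3 * a + v ^ 3 * b) - L * (u ^ 2 * a + v ^ 2 * b)
            + (4 * ((u ^ 3 * a - v ^ 3 * b) / w) - L * ((u ^ 2 * a - v ^ 2 * b) / w)) * w)
            * (pi * L\<^sup>2 / (16 * w))"
      unfolding A' B' using w by (simp add: field_simps power2_eq_square)
    with 1 show "(\<lambda>m. g m * ((u ^ Suc m * a - v ^ Suc m * b) / sqrt 5 / L ^ Suc m)) sums
       (((u ^ 3 * a - v ^ 3 * b) / sqrt 5 + L / 2 * ((u ^ 2 * a - v ^ 2 * b) / sqrt 5)) * (L / 2)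
        + (L * (u ^ 2 * a + v ^ 2 * b) - 4 * (u ^ 3 * a + v ^ 3 * b)) * (L\<^sup>2 / (4 * sqrt 5)) * t
        + (4 * (u ^ 3 * a + v ^ 3 * b) - L * (u ^ 2 * a + v ^ 2 * b)
            + (4 * ((u ^ 3 * a - v ^ 3 * b) / sqrt 5) - L * ((u ^ 2 * a - v ^ 2 * b) / sqrt 5)) * sqrt 5)
            * (pi * L\<^sup>2 / (16 * sqrt 5)))"
      unfolding w_def by (simp only:)
    have "a * A + b * B =
       (u ^ 3 * a + v ^ 3 * b + L / 2 * (u ^ 2 * a + v ^ 2 * b)) * (L / 2)
        + (L * ((u ^ 2 * a - v ^ 2 * b) / w) - 4 * ((u ^ 3 * a - v ^ 3 * b) / w)) * (L\<^sup>2 * w / 4) * t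
        + (4 * (u ^ 3 * a + v ^ 3 * b) - L * (u ^ 2 * a + v ^ 2 * b)
            + (4 * ((u ^ 3 * a - v ^ 3 * b) / w) - L * ((u ^ 2 * a - v ^ 2 * b) / w)) * w)
            * (pi * L\<^sup>2 / 16)"
      unfolding A' B' using w by (simp add: field_simps power2_eq_square)
    with 2 show "(\<lambda>m. g m * ((u ^ Suc m * a + v ^ Suc m * b) / L ^ Suc m)) sums
       ((u ^ 3 * a + v ^ 3 * b + L / 2 * (u ^ 2 * a + v ^ 2 * b)) * (L / 2)
        + (L * ((u ^ 2 * a - v ^ 2 * b) / sqrt 5) - 4 * ((u ^ 3 * a - v ^ 3 * b) / sqrt 5)) * (L\<^sup>2 * sqrt 5 / 4) * t
        + (4 * (u ^ 3 * a + v ^ 3 * b) - L * (u ^ 2 * a + v ^ 2 * b)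
            + (4 * ((u ^ 3 * a - v ^ 3 * b) / sqrt 5) - L * ((u ^ 2 * a - v ^ 2 * b) / sqrt 5)) * sqrt 5)
            * (pi * L\<^sup>2 / 16))"
      unfolding w_def by (simp only:)
  qed
qed

end
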